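(* Let $(A,d)$ be a dg-division algebra and suppose that the set of homogeneous left regular elements of $\ker(d)$ coincides with the set of homogeneous right regular elements of $\ker(d)$. Then either $(A,d)$ is acyclic or $d=0$. Further, $R:=\ker(d)$, with degree $0$ component $R_0$, is either concentrated in degree $0$, or else it is a twisted Laurent polynomial ring $\ker(d)=R_0[T,T^{-1};\sigma]$ for some automorphism $\sigma$ of $R_0$, with $Tr=\sigma(r)T$ for all $r\in R_0$.
   Context: Rings are associative with unit. For a commutative ring $K$, a dg-$K$-algebra $(A,d)$ is a $\mathbb{Z}$-graded $K$-algebra $A$ with a graded $K$-linear endomorphism $d$ of degree $1$ such that $d^2=0$ and $d(ab)=d(a)b+(-1)^{|a|}a\,d(b)$ for all homogeneous $a,b\in A$. Then $\ker(d)$ is a $\mathbb{Z}$-graded subring of $A$. A dg-left (resp. dg-right) ideal of $(A,d)$ is a $\mathbb{Z}$-graded left (resp. right) ideal $I$ with $d(I)\subseteq I$. $(A,d)$ is a dg-division algebra if it contains no dg-left ideal and no dg-right ideal other than $0$ and $A$. $(A,d)$ is acyclic if $H(A,d)=\ker(d)/\mathrm{im}(d)=0$. A homogeneous element $u$ of $\ker(d)$ is right regular in $\ker(d)$ if $ux=0$ with $x\in\ker(d)$ implies $x=0$, and left regular in $\ker(d)$ if $xu=0$ with $x\in\ker(d)$ implies $x=0$. In the twisted Laurent polynomial ring $R_0[T,T^{-1};\sigma]$ (free as a left $R_0$-module on the powers $T^n$, $n\in\mathbb{Z}$), the elements of $R_0$ have degree $0$ and $T$ is homogeneous of nonzero degree.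 *)

theory Defs
  imports "HOL-Algebra.Module" "HOL-Algebra.QuotRing"
begin

section \<open>Graded and differential graded algebras\<close>

text \<open>
  A grading is given by its family of homogeneous components, indexed by the integers.
  A finite decomposition of an element x is a finitely supported family f of homogeneous
  elements (of prescribed degrees) with sum x.
\<close>

definition is_decomposition ::
    "('a, 'm) ring_scheme \<Rightarrow> (int \<Rightarrow> 'a set) \<Rightarrow> (int \<Rightarrow> 'a) \<Rightarrow> 'a \<Rightarrow> bool" where
  "is_decomposition A gr f x \<longleftrightarrow>
     (\<forall>n. f n \<in> gr n) \<and> finite {n. f n \<noteq> \<zero>\<^bsub>A\<^esub>} \<and>
     x = (\<Oplus>\<^bsub>A\<^esub>n\<in>{n. f n \<noteq> \<zero>\<^bsub>A\<^esub>}. f n)"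

text \<open>
  The library locale \<open>algebra\<close> only covers commutative algebras, so the algebra
  structure is assembled from \<open>module\<close> and \<open>ring\<close>. No nontriviality is assumed:
  both the ground ring and the algebra may be the zero ring.
\<close>

locale graded_algebra = module K A + A: ring A
  for K :: "('k, 'm) ring_scheme" and A :: "('k, 'a, 'n) module_scheme" +
  fixes gr :: "int \<Rightarrow> 'a set"
  assumes smult_mult_left:
      "\<lbrakk>k \<in> carrier K; x \<in> carrier A; y \<in> carrier A\<rbrakk>
        \<Longrightarrow> (k \<odot>\<^bsub>A\<^esub> x) \<otimes>\<^bsub>A\<^esub> y = k \<odot>\<^bsub>A\<^esub> (x \<otimes>\<^bsub>A\<^esub> y)"
    and smult_mult_right:
      "\<lbrakk>k \<in> carrier K; x \<in> carrier A; y \<in> carrier A\<rbrakk>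
        \<Longrightarrow> x \<otimes>\<^bsub>A\<^esub> (k \<odot>\<^bsub>A\<^esub> y) = k \<odot>\<^bsub>A\<^esub> (x \<otimes>\<^bsub>A\<^esub> y)"
    and gr_subgroup: "additive_subgroup (gr n) A"
    and gr_smult: "\<lbrakk>k \<in> carrier K; x \<in> gr n\<rbrakk> \<Longrightarrow> k \<odot>\<^bsub>A\<^esub> x \<in> gr n"
    and gr_mult: "\<lbrakk>x \<in> gr i; y \<in> gr j\<rbrakk> \<Longrightarrow> x \<otimes>\<^bsub>A\<^esub> y \<in> gr (i + j)"
    and direct_sum: "x \<in> carrier A \<Longrightarrow> \<exists>!f. is_decomposition A gr f x"

locale dg_algebra = graded_algebra K A gr
  for K :: "('k, 'm) ring_scheme" and A :: "('k, 'a, 'n) module_scheme"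
    and gr :: "int \<Rightarrow> 'a set" +
  fixes d :: "'a \<Rightarrow> 'a"
  assumes d_closed: "x \<in> carrier A \<Longrightarrow> d x \<in> carrier A"
    and d_add: "\<lbrakk>x \<in> carrier A; y \<in> carrier A\<rbrakk> \<Longrightarrow> d (x \<oplus>\<^bsub>A\<^esub> y) = d x \<oplus>\<^bsub>A\<^esub> d y"
    and d_smult: "\<lbrakk>k \<in> carrier K; x \<in> carrier A\<rbrakk> \<Longrightarrow> d (k \<odot>\<^bsub>A\<^esub> x) = k \<odot>\<^bsub>A\<^esub> d x"
    and d_degree: "x \<in> gr n \<Longrightarrow> d x \<in> gr (n + 1)"
    and d_square: "x \<in> carrier A \<Longrightarrow> d (d x) = \<zero>\<^bsub>A\<^esub>"
    and d_leibniz: "\<lbrakk>x \<in> gr i; y \<in> gr j\<rbrakk> \<Longrightarrow>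
          d (x \<otimes>\<^bsub>A\<^esub> y) =
            d x \<otimes>\<^bsub>A\<^esub> y \<oplus>\<^bsub>A\<^esub> (if even i then x \<otimes>\<^bsub>A\<^esub> d y else \<ominus>\<^bsub>A\<^esub> (x \<otimes>\<^bsub>A\<^esub> d y))"

definition dg_left_ideal ::
    "('a, 'm) ring_scheme \<Rightarrow> (int \<Rightarrow> 'a set) \<Rightarrow> ('a \<Rightarrow> 'a) \<Rightarrow> 'a set \<Rightarrow> bool" where
  "dg_left_ideal A gr d I \<longleftrightarrow>
     additive_subgroup I A \<and>
     (\<forall>a\<in>carrier A. \<forall>x\<in>I. a \<otimes>\<^bsub>A\<^esub> x \<in> I) \<and>
     (\<forall>x\<in>I. \<exists>f. is_decomposition A (\<lambda>n. I \<inter> gr n) f x) \<and>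
     d ` I \<subseteq> I"

definition dg_right_ideal ::
    "('a, 'm) ring_scheme \<Rightarrow> (int \<Rightarrow> 'a set) \<Rightarrow> ('a \<Rightarrow> 'a) \<Rightarrow> 'a set \<Rightarrow> bool" where
  "dg_right_ideal A gr d I \<longleftrightarrow>
     additive_subgroup I A \<and>
     (\<forall>a\<in>carrier A. \<forall>x\<in>I. x \<otimes>\<^bsub>A\<^esub> a \<in> I) \<and>
     (\<forall>x\<in>I. \<exists>f. is_decomposition A (\<lambda>n. I \<inter> gr n) f x) \<and>
     d ` I \<subseteq> I"

locale dg_division_algebra = dg_algebra K A gr d
  for K :: "('k, 'm) ring_scheme" and A :: "('k, 'a, 'n) module_scheme"
    and gr :: "int \<Rightarrow> 'a set" and d :: "'a \<Rightarrow> 'a" +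
  assumes no_dg_left_ideal: "dg_left_ideal A gr d I \<Longrightarrow> I = {\<zero>\<^bsub>A\<^esub>} \<or> I = carrier A"
    and no_dg_right_ideal: "dg_right_ideal A gr d I \<Longrightarrow> I = {\<zero>\<^bsub>A\<^esub>} \<or> I = carrier A"


section \<open>Cycles and homology\<close>

definition cycles :: "('a, 'm) ring_scheme \<Rightarrow> ('a \<Rightarrow> 'a) \<Rightarrow> 'a set" where
  "cycles A d = {x \<in> carrier A. d x = \<zero>\<^bsub>A\<^esub>}"

definition ker_ring :: "('a, 'm) ring_scheme \<Rightarrow> ('a \<Rightarrow> 'a) \<Rightarrow> ('a, 'm) ring_scheme" where
  "ker_ring A d = A\<lparr>carrier := cycles A d\<rparr>"

definition ker_comp ::
    "('a, 'm) ring_scheme \<Rightarrow> (int \<Rightarrow> 'a set) \<Rightarrow> ('a \<Rightarrow> 'a) \<Rightarrow> int \<Rightarrow> 'a set" where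
  "ker_comp A gr d n = cycles A d \<inter> gr n"

definition ker_ring0 ::
    "('a, 'm) ring_scheme \<Rightarrow> (int \<Rightarrow> 'a set) \<Rightarrow> ('a \<Rightarrow> 'a) \<Rightarrow> ('a, 'm) ring_scheme" where
  "ker_ring0 A gr d = A\<lparr>carrier := ker_comp A gr d 0\<rparr>"

definition homology :: "('a, 'm) ring_scheme \<Rightarrow> ('a \<Rightarrow> 'a) \<Rightarrow> 'a set monoid" where
  "homology A d = ker_ring A d A_Mod (d ` carrier A)"

definition acyclic_dg :: "('a, 'm) ring_scheme \<Rightarrow> ('a \<Rightarrow> 'a) \<Rightarrow> bool" where
  "acyclic_dg A d \<longleftrightarrow> carrier (homology A d) = {\<one>\<^bsub>homology A d\<^esub>}"

definition hom_right_regular ::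
    "('a, 'm) ring_scheme \<Rightarrow> (int \<Rightarrow> 'a set) \<Rightarrow> ('a \<Rightarrow> 'a) \<Rightarrow> 'a set" where
  "hom_right_regular A gr d =
     {u \<in> (\<Union>n. ker_comp A gr d n). \<forall>x\<in>cycles A d. u \<otimes>\<^bsub>A\<^esub> x = \<zero>\<^bsub>A\<^esub> \<longrightarrow> x = \<zero>\<^bsub>A\<^esub>}"

definition hom_left_regular ::
    "('a, 'm) ring_scheme \<Rightarrow> (int \<Rightarrow> 'a set) \<Rightarrow> ('a \<Rightarrow> 'a) \<Rightarrow> 'a set" where
  "hom_left_regular A gr d =
     {u \<in> (\<Union>n. ker_comp A gr d n). \<forall>x\<in>cycles A d. x \<otimes>\<^bsub>A\<^esub> u = \<zero>\<^bsub>A\<^esub> \<longrightarrow> x = \<zero>\<^bsub>A\<^esub>}"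


section \<open>Twisted Laurent polynomial rings\<close>

definition aut_pow :: "('a, 'm) ring_scheme \<Rightarrow> ('a \<Rightarrow> 'a) \<Rightarrow> int \<Rightarrow> 'a \<Rightarrow> 'a" where
  "aut_pow S \<sigma> i =
     (if 0 \<le> i then \<sigma> ^^ nat i else inv_into (carrier S) \<sigma> ^^ nat (- i))"

text \<open>
  The finitely supported family f stands for the left-coefficient polynomial
  \<open>\<Sum>n. f n T\<^sup>n\<close>; the multiplication is the one determined by
  \<open>(a T\<^sup>i) (b T\<^sup>j) = a \<sigma>\<^sup>i(b) T\<^sup>i\<^sup>+\<^sup>j\<close>, i.e. by \<open>T r = \<sigma>(r) T\<close>.
\<close>

definition twisted_laurent :: "('a, 'm) ring_scheme \<Rightarrow> ('a \<Rightarrow> 'a) \<Rightarrow> (int \<Rightarrow> 'a) ring" where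
  "twisted_laurent S \<sigma> =
     \<lparr>carrier = {f. (\<forall>n. f n \<in> carrier S) \<and> finite {n. f n \<noteq> \<zero>\<^bsub>S\<^esub>}},
      mult = (\<lambda>f g n. \<Oplus>\<^bsub>S\<^esub>i\<in>{i. f i \<noteq> \<zero>\<^bsub>S\<^esub>}. f i \<otimes>\<^bsub>S\<^esub> aut_pow S \<sigma> i (g (n - i))),
      one = (\<lambda>n. if n = 0 then \<one>\<^bsub>S\<^esub> else \<zero>\<^bsub>S\<^esub>),
      zero = (\<lambda>n. \<zero>\<^bsub>S\<^esub>),
      add = (\<lambda>f g n. f n \<oplus>\<^bsub>S\<^esub> g n)\<rparr>"

definition laurent_monom :: "('a, 'm) ring_scheme \<Rightarrow> 'a \<Rightarrow> int \<Rightarrow> int \<Rightarrow> 'a" where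
  "laurent_monom S a k = (\<lambda>n. if n = k then a else \<zero>\<^bsub>S\<^esub>)"

text \<open>The grading in which the coefficients have degree 0 and T has degree m.\<close>

definition laurent_comp ::
    "('a, 'm) ring_scheme \<Rightarrow> ('a \<Rightarrow> 'a) \<Rightarrow> int \<Rightarrow> int \<Rightarrow> (int \<Rightarrow> 'a) set" where
  "laurent_comp S \<sigma> m k =
     {f \<in> carrier (twisted_laurent S \<sigma>). \<forall>n. f n \<noteq> \<zero>\<^bsub>S\<^esub> \<longrightarrow> n * m = k}"

end

(* A nonzero homogeneous cycle x generates the dg-left ideal A x, which is therefore A, so x has a
   left inverse y; if d y were nonzero it would itself have a left inverse, contradicting
   (d y) x = d (y x) = 0.  Hence every nonzero homogeneous cycle is invertible in ker d.  If some
   d a is nonzero, its inverse makes 1 a boundary, so A is acyclic.  The degrees of nonzero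
   homogeneous cycles form a subgroup of the integers; a nonzero cycle T in the smallest positive
   degree m of it gives ker(d) in degree n m as R_0 T^n, with sigma conjugation by T. *)
theory Submission
  imports Defs "HOL-Algebra.Subrings"
begin

text \<open>The degree axioms and the Leibniz rule concern homogeneous elements, and a grading is
  given only by unique decompositions, so the proof rests on the component projections. They allow
  an inverse of a cycle of degree n to be taken homogeneous: since 1 has degree 0, a left inverse
  may be replaced by its component of degree -n. One-sided inverses suffice, because the left
  inverse y of x is again a nonzero homogeneous cycle; its own left inverse must then be x. The
  isomorphism with the Laurent ring is built starting from ker(d): the coefficient of
  \<open>T^n\<close> in x is \<open>x_{nm} T^{-n}\<close>, and rewriting
  \<open>x_{im} y_{(n-i)m} T^{-n}\<close> in these coefficients produces exactly the twist by
  conjugation with \<open>T^i\<close>.\<close>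

section \<open>Homogeneous components in a graded algebra\<close>

context graded_algebra
begin

text \<open>The description is meaningful on the carrier, where \<open>direct_sum\<close> gives
  unique existence; for other x the value is arbitrary.\<close>

definition component :: "'a \<Rightarrow> int \<Rightarrow> 'a" where
  "component x = (THE f. is_decomposition A gr f x)"

lemma gr_subset: "gr n \<subseteq> carrier A"
  using additive_subgroup.a_subset[OF gr_subgroup] .

lemma gr_carrier: "x \<in> gr n \<Longrightarrow> x \<in> carrier A"
  using gr_subset by blast

lemma gr_zero [simp]: "\<zero>\<^bsub>A\<^esub> \<in> gr n"
  using additive_subgroup.zero_closed[OF gr_subgroup] .

lemma gr_add: "x \<in> gr n \<Longrightarrow> y \<in> gr n \<Longrightarrow> x \<oplus>\<^bsub>A\<^esub> y \<in> gr n"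
  using additive_subgroup.a_closed[OF gr_subgroup] .

lemma gr_minus: "x \<in> gr n \<Longrightarrow> \<ominus>\<^bsub>A\<^esub> x \<in> gr n"
  using additive_subgroup.a_inv_closed[OF gr_subgroup] .

lemma component_decomposition:
  "x \<in> carrier A \<Longrightarrow> is_decomposition A gr (component x) x"
  unfolding component_def using direct_sum by (rule theI')

lemma component_gr: "x \<in> carrier A \<Longrightarrow> component x n \<in> gr n"
  using component_decomposition by (simp add: is_decomposition_def)

lemma component_closed: "x \<in> carrier A \<Longrightarrow> component x n \<in> carrier A"
  using component_gr gr_carrier by blast

lemma component_finite: "x \<in> carrier A \<Longrightarrow> finite {n. component x n \<noteq> \<zero>\<^bsub>A\<^esub>}"
  using component_decomposition by (simp add: is_decomposition_def)

text \<open>Allowing any finite superset of the support lets elements with different supports be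
  summed over a common index set.\<close>

lemma component_sum:
  assumes "x \<in> carrier A" "finite S" "{n. component x n \<noteq> \<zero>\<^bsub>A\<^esub>} \<subseteq> S"
  shows "(\<Oplus>\<^bsub>A\<^esub>n\<in>S. component x n) = x"
proof -
  have "(\<Oplus>\<^bsub>A\<^esub>n\<in>S. component x n) = (\<Oplus>\<^bsub>A\<^esub>n\<in>{n. component x n \<noteq> \<zero>\<^bsub>A\<^esub>}. component x n)"
    using assms by (intro M.add.finprod_mono_neutral_cong_right) (auto intro: component_closed)
  then show ?thesis
    using component_decomposition[OF assms(1)] by (simp add: is_decomposition_def)
qed

text \<open>The way to compute components: exhibit a homogeneous family with the right sum. The set
  \<open>S\<close> may exceed the support, so no exact support has to be determined.\<close>

lemma component_unique:
  assumes "\<And>n. f n \<in> gr n" "finite S" "\<And>n. n \<notin> S \<Longrightarrow> f n = \<zero>\<^bsub>A\<^esub>" "x = (\<Oplus>\<^bsub>A\<^esub>n\<in>S. f n)"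
  shows "component x = f"
proof -
  have f: "f n \<in> carrier A" for n using assms(1) gr_carrier by blast
  then have x: "x \<in> carrier A" unfolding assms(4) by (simp add: M.finsum_closed)
  have sub: "{n. f n \<noteq> \<zero>\<^bsub>A\<^esub>} \<subseteq> S" using assms(3) by blast
  have "x = (\<Oplus>\<^bsub>A\<^esub>n\<in>{n. f n \<noteq> \<zero>\<^bsub>A\<^esub>}. f n)"
    unfolding assms(4) using assms(2) sub f
    by (intro M.add.finprod_mono_neutral_cong_right) auto
  then have "is_decomposition A gr f x"
    using assms(1) finite_subset[OF sub assms(2)] by (simp add: is_decomposition_def)
  then show ?thesis
    using direct_sum[OF x] component_decomposition[OF x] by blast
qed

lemma component_homogeneous:
  assumes "x \<in> gr n"
  shows "component x k = (if k = n then x else \<zero>\<^bsub>A\<^esub>)"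
proof -
  have "component x = (\<lambda>k. if k = n then x else \<zero>\<^bsub>A\<^esub>)"
    using assms gr_carrier[OF assms] by (intro component_unique[where S = "{n}"]) auto
  then show ?thesis by simp
qed

lemma component_zero [simp]: "component \<zero>\<^bsub>A\<^esub> n = \<zero>\<^bsub>A\<^esub>"
  using component_homogeneous[OF gr_zero] by simp

lemma component_add:
  assumes "x \<in> carrier A" "y \<in> carrier A"
  shows "component (x \<oplus>\<^bsub>A\<^esub> y) k = component x k \<oplus>\<^bsub>A\<^esub> component y k"
proof -
  let ?S = "{n. component x n \<noteq> \<zero>\<^bsub>A\<^esub>} \<union> {n. component y n \<noteq> \<zero>\<^bsub>A\<^esub>}"
  have fin: "finite ?S" using assms by (simp add: component_finite)
  have "(\<Oplus>\<^bsub>A\<^esub>n\<in>?S. component x n \<oplus>\<^bsub>A\<^esub> component y n) =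
      (\<Oplus>\<^bsub>A\<^esub>n\<in>?S. component x n) \<oplus>\<^bsub>A\<^esub> (\<Oplus>\<^bsub>A\<^esub>n\<in>?S. component y n)"
    using assms by (intro M.finsum_addf) (auto intro: component_closed)
  also have "\<dots> = x \<oplus>\<^bsub>A\<^esub> y"
    using assms fin by (simp add: component_sum)
  finally have "component (x \<oplus>\<^bsub>A\<^esub> y) = (\<lambda>n. component x n \<oplus>\<^bsub>A\<^esub> component y n)"
    using fin assms by (intro component_unique[where S = ?S]) (auto intro: gr_add component_gr)
  then show ?thesis by simp
qed

lemma component_finsum:
  assumes "finite S" "\<And>i. i \<in> S \<Longrightarrow> f i \<in> carrier A"
  shows "component (\<Oplus>\<^bsub>A\<^esub>i\<in>S. f i) k = (\<Oplus>\<^bsub>A\<^esub>i\<in>S. component (f i) k)"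
  using assms
proof (induction S rule: finite_induct)
  case empty
  then show ?case using component_homogeneous[OF gr_zero[of k], of k] by simp
next
  case (insert i S)
  then have "(\<Oplus>\<^bsub>A\<^esub>i\<in>insert i S. f i) = f i \<oplus>\<^bsub>A\<^esub> (\<Oplus>\<^bsub>A\<^esub>i\<in>S. f i)"
    by (intro M.finsum_insert) auto
  moreover have "(\<Oplus>\<^bsub>A\<^esub>i\<in>insert i S. component (f i) k) =
      component (f i) k \<oplus>\<^bsub>A\<^esub> (\<Oplus>\<^bsub>A\<^esub>i\<in>S. component (f i) k)"
    using insert by (intro M.finsum_insert) (auto intro: component_closed)
  moreover have "(\<Oplus>\<^bsub>A\<^esub>i\<in>S. f i) \<in> carrier A"
    using insert.prems by (intro M.finsum_closed) auto
  ultimately show ?case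
    using insert by (simp add: component_add)
qed

text \<open>Carries additive statements from homogeneous elements, where \<open>gr_mult\<close> and
  \<open>d_leibniz\<close> apply, to the whole algebra.\<close>

lemma homogeneous_induct [consumes 1, case_names zero homogeneous add]:
  assumes "x \<in> carrier A"
    and zero: "P \<zero>\<^bsub>A\<^esub>"
    and hom: "\<And>n x. x \<in> gr n \<Longrightarrow> P x"
    and add: "\<And>x y. x \<in> carrier A \<Longrightarrow> y \<in> carrier A \<Longrightarrow> P x \<Longrightarrow> P y \<Longrightarrow> P (x \<oplus>\<^bsub>A\<^esub> y)"
  shows "P x"
proof -
  have "P (\<Oplus>\<^bsub>A\<^esub>n\<in>S. component x n)" if "finite S" for S
    using that
  proof (induction S rule: finite_induct)
    case empty
    then show ?case using zero by simp
  next
    case (insert n S)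
    have "(\<Oplus>\<^bsub>A\<^esub>n\<in>insert n S. component x n) = component x n \<oplus>\<^bsub>A\<^esub> (\<Oplus>\<^bsub>A\<^esub>n\<in>S. component x n)"
      using insert assms(1) by (intro M.finsum_insert) (auto intro: component_closed)
    moreover have "(\<Oplus>\<^bsub>A\<^esub>n\<in>S. component x n) \<in> carrier A"
      using assms(1) by (intro M.finsum_closed) (auto intro: component_closed)
    ultimately show ?case
      using add hom[OF component_gr[OF assms(1)]] insert.IH component_closed[OF assms(1)] by simp
  qed
  from this[OF component_finite[OF assms(1)]] show ?thesis
    using assms(1) by (simp add: component_sum component_finite)
qed

lemma component_eqI:
  assumes "x \<in> carrier A" "y \<in> carrier A" "\<And>n. component x n = component y n"
  shows "x = y"
proof -
  have "component x = component y" using assms(3) by blast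
  then have "is_decomposition A gr (component x) y"
    using component_decomposition[OF assms(2)] by simp
  then show ?thesis
    using component_decomposition[OF assms(1)] unfolding is_decomposition_def by metis
qed

text \<open>Both sides are additive in a, and for homogeneous a the product has a single degree.
  This makes the left ideal generated by x graded and inverses homogeneous.\<close>

lemma component_mult_right:
  assumes "a \<in> carrier A" "x \<in> gr j"
  shows "component (a \<otimes>\<^bsub>A\<^esub> x) n = component a (n - j) \<otimes>\<^bsub>A\<^esub> x"
  using assms(1)
proof (induction a rule: homogeneous_induct)
  case zero
  then show ?case
    using gr_carrier[OF assms(2)] component_homogeneous[OF gr_zero[of 0]] by simp
next
  case (homogeneous i a)
  show ?case
    using component_homogeneous[OF gr_mult[OF homogeneous assms(2)]]
      component_homogeneous[OF homogeneous] gr_carrier[OF assms(2)] by auto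
next
  case (add a b)
  then show ?case
    using gr_carrier[OF assms(2)] by (simp add: A.l_distr component_add component_closed)
qed

lemma component_mult_left:
  assumes "a \<in> carrier A" "x \<in> gr j"
  shows "component (x \<otimes>\<^bsub>A\<^esub> a) n = x \<otimes>\<^bsub>A\<^esub> component a (n - j)"
  using assms(1)
proof (induction a rule: homogeneous_induct)
  case zero
  then show ?case
    using gr_carrier[OF assms(2)] component_homogeneous[OF gr_zero[of 0]] by simp
next
  case (homogeneous i a)
  show ?case
    using component_homogeneous[OF gr_mult[OF assms(2) homogeneous]]
      component_homogeneous[OF homogeneous] gr_carrier[OF assms(2)] by auto
next
  case (add a b)
  then show ?case
    using gr_carrier[OF assms(2)] by (simp add: A.r_distr component_add component_closed)
qed

text \<open>Only the left factor is decomposed, so one finite index set suffices. Leaving it free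
  permits summing over multiples of a period later on.\<close>

lemma component_mult:
  assumes "x \<in> carrier A" "y \<in> carrier A" "finite S" "{n. component x n \<noteq> \<zero>\<^bsub>A\<^esub>} \<subseteq> S"
  shows "component (x \<otimes>\<^bsub>A\<^esub> y) k = (\<Oplus>\<^bsub>A\<^esub>i\<in>S. component x i \<otimes>\<^bsub>A\<^esub> component y (k - i))"
proof -
  have "x \<otimes>\<^bsub>A\<^esub> y = (\<Oplus>\<^bsub>A\<^esub>i\<in>S. component x i) \<otimes>\<^bsub>A\<^esub> y"
    using assms by (simp add: component_sum)
  also have "\<dots> = (\<Oplus>\<^bsub>A\<^esub>i\<in>S. component x i \<otimes>\<^bsub>A\<^esub> y)"
    using assms by (intro A.finsum_ldistr) (auto intro: component_closed)
  finally have "component (x \<otimes>\<^bsub>A\<^esub> y) k = (\<Oplus>\<^bsub>A\<^esub>i\<in>S. component (component x i \<otimes>\<^bsub>A\<^esub> y) k)"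
    using assms by (simp add: component_finsum component_closed)
  also have "\<dots> = (\<Oplus>\<^bsub>A\<^esub>i\<in>S. component x i \<otimes>\<^bsub>A\<^esub> component y (k - i))"
    using assms by (intro M.finsum_cong')
      (auto simp: component_mult_left[OF _ component_gr] component_closed)
  finally show ?thesis .
qed

text \<open>The degree \<open>0\<close> component \<open>e\<close> of \<open>1\<close> is a left identity on homogeneous elements,
  by comparing components in \<open>1 x = x\<close>; hence \<open>e = e 1 = 1\<close>.\<close>

lemma one_gr: "\<one>\<^bsub>A\<^esub> \<in> gr 0"
proof -
  let ?e = "component \<one>\<^bsub>A\<^esub> 0"
  have e: "?e \<in> carrier A" by (simp add: component_closed)
  have "?e \<otimes>\<^bsub>A\<^esub> x = x" if "x \<in> carrier A" for x
    using that
  proof (induction x rule: homogeneous_induct)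
    case (homogeneous n x)
    then show ?case
      using component_mult_right[OF A.one_closed homogeneous, of n] gr_carrier[OF homogeneous]
        component_homogeneous[OF homogeneous, of n] by simp
  qed (use e in \<open>simp_all add: A.r_distr\<close>)
  from this[of "\<one>\<^bsub>A\<^esub>"] have "?e = \<one>\<^bsub>A\<^esub>" using e by simp
  then show ?thesis using component_gr[OF A.one_closed, of 0] by simp
qed

end

section \<open>Cycles, principal dg-left ideals and acyclicity\<close>

context dg_algebra
begin

lemma d_zero [simp]: "d \<zero>\<^bsub>A\<^esub> = \<zero>\<^bsub>A\<^esub>"
  using d_add[of "\<zero>\<^bsub>A\<^esub>" "\<zero>\<^bsub>A\<^esub>"] d_closed[of "\<zero>\<^bsub>A\<^esub>"] by simp

text \<open>An additive map of degree 1 respects components up to a shift; consequently the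
  components of a cycle are cycles.\<close>

lemma d_component:
  assumes "x \<in> carrier A"
  shows "d (component x n) = component (d x) (n + 1)"
  using assms
proof (induction x rule: homogeneous_induct)
  case zero
  then show ?case using component_homogeneous[OF gr_zero[of 0]] by simp
next
  case (homogeneous n x)
  then show ?case
    using component_homogeneous[OF homogeneous] component_homogeneous[OF d_degree[OF homogeneous]]
    by simp
next
  case (add x y)
  then show ?case by (simp add: component_add d_add d_closed component_closed)
qed

text \<open>The signed term of the Leibniz rule contains d x = 0. What remains does not depend on
  the degree of a and is additive in a.\<close>

lemma d_mult_cycle:
  assumes "a \<in> carrier A" "x \<in> gr n" "d x = \<zero>\<^bsub>A\<^esub>"
  shows "d (a \<otimes>\<^bsub>A\<^esub> x) = d a \<otimes>\<^bsub>A\<^esub> x"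
  using assms(1)
proof (induction a rule: homogeneous_induct)
  case zero
  then show ?case using gr_carrier[OF assms(2)] by simp
next
  case (homogeneous i a)
  then show ?case
    using d_leibniz[OF homogeneous assms(2)] assms(3) gr_carrier[OF assms(2)] gr_carrier[OF homogeneous]
    by (simp add: d_closed)
next
  case (add a b)
  then show ?case
    using gr_carrier[OF assms(2)] by (simp add: A.l_distr d_add d_closed)
qed

lemma d_one: "d \<one>\<^bsub>A\<^esub> = \<zero>\<^bsub>A\<^esub>"
  using d_leibniz[OF one_gr one_gr] d_closed[of "\<one>\<^bsub>A\<^esub>"] by simp

lemma cycles_carrier: "x \<in> cycles A d \<Longrightarrow> x \<in> carrier A"
  by (simp add: cycles_def)

lemma ker_comp_iff: "x \<in> ker_comp A gr d n \<longleftrightarrow> x \<in> gr n \<and> d x = \<zero>\<^bsub>A\<^esub>"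
  using gr_carrier by (auto simp: ker_comp_def cycles_def)

lemma ker_comp_cycles: "x \<in> ker_comp A gr d n \<Longrightarrow> x \<in> cycles A d"
  by (simp add: ker_comp_def)

lemma ker_comp_closed: "x \<in> ker_comp A gr d n \<Longrightarrow> x \<in> carrier A"
  by (simp add: ker_comp_def cycles_def)

lemma ker_comp_zero: "\<zero>\<^bsub>A\<^esub> \<in> ker_comp A gr d n"
  by (simp add: ker_comp_iff)

lemma ker_comp_mult:
  "x \<in> ker_comp A gr d i \<Longrightarrow> y \<in> ker_comp A gr d j \<Longrightarrow> x \<otimes>\<^bsub>A\<^esub> y \<in> ker_comp A gr d (i + j)"
  using d_mult_cycle[of x y j] by (auto simp: ker_comp_iff gr_mult gr_carrier)

lemma component_cycles: "x \<in> cycles A d \<Longrightarrow> component x n \<in> ker_comp A gr d n"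
  using d_component[of x n] component_homogeneous[OF gr_zero[of 0], of "n + 1"]
  by (simp add: ker_comp_iff cycles_def component_gr split: if_splits)

lemma d_minus: "x \<in> carrier A \<Longrightarrow> d (\<ominus>\<^bsub>A\<^esub> x) = \<ominus>\<^bsub>A\<^esub> d x"
  using d_add[of x "\<ominus>\<^bsub>A\<^esub> x"] by (metis M.add.inv_closed M.minus_equality M.r_neg d_closed d_zero M.a_comm)

text \<open>Here x may be inhomogeneous. For homogeneous a the identity is checked degree by degree,
  where only one component of x contributes and \<open>d_mult_cycle\<close> applies.\<close>

lemma d_mult_cycles:
  assumes "a \<in> carrier A" "x \<in> cycles A d"
  shows "d (a \<otimes>\<^bsub>A\<^esub> x) = d a \<otimes>\<^bsub>A\<^esub> x"
proof (rule component_eqI)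
  have x: "x \<in> carrier A" using assms(2) by (rule cycles_carrier)
  show "d (a \<otimes>\<^bsub>A\<^esub> x) \<in> carrier A" "d a \<otimes>\<^bsub>A\<^esub> x \<in> carrier A"
    using assms x by (simp_all add: d_closed)
  fix n
  show "component (d (a \<otimes>\<^bsub>A\<^esub> x)) n = component (d a \<otimes>\<^bsub>A\<^esub> x) n"
    using assms(1)
  proof (induction a rule: homogeneous_induct)
    case zero
    then show ?case using x by simp
  next
    case (homogeneous i a)
    have a: "a \<in> carrier A" using homogeneous by (rule gr_carrier)
    \<comment> \<open>Degree n of d(a x) comes from degree n - 1 of a x, that is, from a times the
      component of x in degree n - 1 - i.\<close>
    have k: "component x (n - 1 - i) \<in> gr (n - 1 - i)" "d (component x (n - 1 - i)) = \<zero>\<^bsub>A\<^esub>"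
      using component_cycles[OF assms(2)] by (simp_all add: ker_comp_iff)
    have "component (d (a \<otimes>\<^bsub>A\<^esub> x)) n = d (a \<otimes>\<^bsub>A\<^esub> component x (n - 1 - i))"
      using d_component[of "a \<otimes>\<^bsub>A\<^esub> x" "n - 1"] x a component_mult_left[OF x homogeneous] by simp
    also have "\<dots> = d a \<otimes>\<^bsub>A\<^esub> component x (n - 1 - i)"
      by (rule d_mult_cycle[OF a k])
    also have "\<dots> = component (d a \<otimes>\<^bsub>A\<^esub> x) n"
      using component_mult_left[OF x d_degree[OF homogeneous], of n] by (simp add: diff_diff_eq add.commute)
    finally show ?case .
  next
    case (add a b)
    then show ?case
      using x by (simp add: A.l_distr d_add d_closed component_add)
  qed
qed

lemma subring_cycles: "subring (cycles A d) A"
  by (rule A.subringI) (auto simp: cycles_def d_one d_minus d_add d_mult_cycles)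

lemma subring_ker_comp0: "subring (ker_comp A gr d 0) A"
  by (rule A.subringI)
    (use ker_comp_mult[of _ 0 _ 0] in \<open>auto simp: ker_comp_iff one_gr d_one d_minus d_add gr_add gr_minus gr_carrier\<close>)

text \<open>Stability under \<open>d\<close> is d(a x) = (d a) x; gradedness holds because each
  component of a x is a component of a times x.\<close>

lemma principal_dg_left_ideal:
  assumes "x \<in> ker_comp A gr d j"
  shows "dg_left_ideal A gr d ((\<lambda>a. a \<otimes>\<^bsub>A\<^esub> x) ` carrier A)"
proof -
  let ?I = "(\<lambda>a. a \<otimes>\<^bsub>A\<^esub> x) ` carrier A"
  have xg: "x \<in> gr j" and dx: "d x = \<zero>\<^bsub>A\<^esub>" and x: "x \<in> carrier A"
    using assms ker_comp_closed by (auto simp: ker_comp_iff)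
  have "additive_subgroup ?I A"
  proof (rule additive_subgroup.intro, rule M.add.subgroupI)
    fix y assume "y \<in> ?I"
    then obtain a where a: "a \<in> carrier A" "y = a \<otimes>\<^bsub>A\<^esub> x" by blast
    have "\<ominus>\<^bsub>A\<^esub> y = (\<ominus>\<^bsub>A\<^esub> a) \<otimes>\<^bsub>A\<^esub> x" using a x by (simp add: A.l_minus)
    then show "\<ominus>\<^bsub>A\<^esub> y \<in> ?I" using a(1) by blast
    fix z assume "z \<in> ?I"
    then obtain b where b: "b \<in> carrier A" "z = b \<otimes>\<^bsub>A\<^esub> x" by blast
    have "y \<oplus>\<^bsub>A\<^esub> z = (a \<oplus>\<^bsub>A\<^esub> b) \<otimes>\<^bsub>A\<^esub> x" using a b x by (simp add: A.l_distr)
    then show "y \<oplus>\<^bsub>A\<^esub> z \<in> ?I" using a(1) b(1) by blast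
  qed (use x in auto)
  moreover have "b \<otimes>\<^bsub>A\<^esub> y \<in> ?I" if b: "b \<in> carrier A" and y: "y \<in> ?I" for b y
  proof -
    obtain a where a: "a \<in> carrier A" "y = a \<otimes>\<^bsub>A\<^esub> x" using y by blast
    have "b \<otimes>\<^bsub>A\<^esub> y = (b \<otimes>\<^bsub>A\<^esub> a) \<otimes>\<^bsub>A\<^esub> x" using a b x by (simp add: A.m_assoc)
    then show ?thesis using a(1) b by blast
  qed
  moreover have "\<exists>f. is_decomposition A (\<lambda>n. ?I \<inter> gr n) f y" if y: "y \<in> ?I" for y
  proof
    obtain a where a: "a \<in> carrier A" "y = a \<otimes>\<^bsub>A\<^esub> x" using y by blast
    then have "component y n \<in> ?I" for n
      using component_mult_right[OF a(1) xg, of n] component_closed[OF a(1), of "n - j"] by blast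
    then show "is_decomposition A (\<lambda>n. ?I \<inter> gr n) (component y) y"
      using component_decomposition[of y] a x by (simp add: is_decomposition_def)
  qed
  moreover have "d ` ?I \<subseteq> ?I"
    using d_mult_cycle[OF _ xg dx] by (auto simp: d_closed)
  ultimately show ?thesis unfolding dg_left_ideal_def by blast
qed

text \<open>Homology is a quotient group, so its vanishing means that there is a single coset. Once
  the boundaries are all cycles, every coset is the full set of cycles.\<close>

lemma acyclicI:
  assumes "\<And>x. x \<in> cycles A d \<Longrightarrow> x \<in> d ` carrier A"
  shows "acyclic_dg A d"
proof -
  have im: "d ` carrier A = cycles A d"
    using assms by (auto simp: cycles_def d_closed d_square)
  interpret Z: ring "ker_ring A d"
    unfolding ker_ring_def by (rule A.subring_is_ring[OF subring_cycles])
  have "carrier (ker_ring A d) = cycles A d" by (simp add: ker_ring_def)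
  then have sub: "subgroup (cycles A d) (add_monoid (ker_ring A d))"
    using Z.add.subgroup_self by simp
  have ne: "\<zero>\<^bsub>ker_ring A d\<^esub> \<in> cycles A d"
    using Z.zero_closed by (simp add: ker_ring_def)
  show ?thesis
    unfolding acyclic_dg_def homology_def im A_FactGroup_def carrier_FactGroup
    using Z.add.coset_join2[OF _ sub] ne by (auto simp: ker_ring_def)
qed

end

section \<open>Invertibility of nonzero homogeneous cycles\<close>

context dg_division_algebra
begin

lemma homogeneous_cycle_left_inverse:
  assumes "x \<in> ker_comp A gr d n" "x \<noteq> \<zero>\<^bsub>A\<^esub>"
  shows "\<exists>y\<in>gr (- n). y \<otimes>\<^bsub>A\<^esub> x = \<one>\<^bsub>A\<^esub>"
proof -
  let ?I = "(\<lambda>a. a \<otimes>\<^bsub>A\<^esub> x) ` carrier A"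
  have xg: "x \<in> gr n" and x: "x \<in> carrier A"
    using assms ker_comp_closed by (auto simp: ker_comp_iff)
  have "x \<in> ?I" using x by (auto intro!: image_eqI[of _ _ "\<one>\<^bsub>A\<^esub>"])
  then have "?I = carrier A"
    using no_dg_left_ideal[OF principal_dg_left_ideal[OF assms(1)]] assms(2) by auto
  then obtain a where a: "a \<in> carrier A" "\<one>\<^bsub>A\<^esub> = a \<otimes>\<^bsub>A\<^esub> x"
    by (metis A.one_closed imageE)
  \<comment> \<open>This is the degree 0 component of 1 = a x, where 1 is its own degree 0 component
    by \<open>one_gr\<close>.\<close>
  have "component a (- n) \<otimes>\<^bsub>A\<^esub> x = \<one>\<^bsub>A\<^esub>"
    using component_mult_right[OF a(1) xg, of 0] a(2) component_homogeneous[OF one_gr, of 0] by simp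
  then show ?thesis using component_gr[OF a(1)] by blast
qed

lemma homogeneous_cycle_inverse:
  assumes "x \<in> ker_comp A gr d n" "x \<noteq> \<zero>\<^bsub>A\<^esub>"
  shows "\<exists>y\<in>ker_comp A gr d (- n). y \<otimes>\<^bsub>A\<^esub> x = \<one>\<^bsub>A\<^esub> \<and> x \<otimes>\<^bsub>A\<^esub> y = \<one>\<^bsub>A\<^esub>"
proof -
  have x: "x \<in> carrier A" using assms(1) by (rule ker_comp_closed)
  have nz: "\<one>\<^bsub>A\<^esub> \<noteq> \<zero>\<^bsub>A\<^esub>"
    using assms(2) x by (metis A.l_null A.l_one)
  obtain y where y: "y \<in> gr (- n)" "y \<otimes>\<^bsub>A\<^esub> x = \<one>\<^bsub>A\<^esub>"
    using homogeneous_cycle_left_inverse[OF assms] by blast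
  have yc: "y \<in> carrier A" using y(1) by (rule gr_carrier)
  have dyx: "d y \<otimes>\<^bsub>A\<^esub> x = \<zero>\<^bsub>A\<^esub>"
    using d_mult_cycle[OF yc, of x n] assms(1) y(2) d_one by (simp add: ker_comp_iff)
  have "d y = \<zero>\<^bsub>A\<^esub>"
  proof (rule ccontr)
    assume "d y \<noteq> \<zero>\<^bsub>A\<^esub>"
    \<comment> \<open>Although y is not yet known to be a cycle, d y is one by
      \<open>d_square\<close>, so the left inverse lemma applies to it.\<close>
    moreover have "d y \<in> ker_comp A gr d (- n + 1)"
      using y(1) yc by (simp only: ker_comp_iff d_degree d_square simp_thms)
    ultimately obtain z where z: "z \<in> carrier A" "z \<otimes>\<^bsub>A\<^esub> d y = \<one>\<^bsub>A\<^esub>"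
      using homogeneous_cycle_left_inverse gr_carrier by blast
    have "x = z \<otimes>\<^bsub>A\<^esub> d y \<otimes>\<^bsub>A\<^esub> x" using z x by simp
    also have "\<dots> = \<zero>\<^bsub>A\<^esub>" using z(1) x yc dyx by (simp add: A.m_assoc d_closed)
    finally show False using assms(2) by contradiction
  qed
  then have yk: "y \<in> ker_comp A gr d (- n)" using y(1) by (simp add: ker_comp_iff)
  have "y \<noteq> \<zero>\<^bsub>A\<^esub>" using y(2) x nz by auto
  then obtain z where z: "z \<in> carrier A" "z \<otimes>\<^bsub>A\<^esub> y = \<one>\<^bsub>A\<^esub>"
    using homogeneous_cycle_left_inverse[OF yk] gr_carrier by blast
  \<comment> \<open>The element y has the left inverse z and the right inverse x, which forces z =
    x.\<close>
  have "x \<otimes>\<^bsub>A\<^esub> y = \<one>\<^bsub>A\<^esub>"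
    using A.inv_unique[OF z(2) y(2) yc z(1) x] z(2) by simp
  then show ?thesis using yk y(2) by blast
qed

text \<open>The case split is on homogeneous elements: if \<open>d\<close> kills them it vanishes by
  additivity, and otherwise some nonzero boundary is homogeneous, hence invertible.\<close>

lemma acyclic_or_zero_differential: "acyclic_dg A d \<or> (\<forall>x\<in>carrier A. d x = \<zero>\<^bsub>A\<^esub>)"
proof (cases "\<forall>n. \<forall>x\<in>gr n. d x = \<zero>\<^bsub>A\<^esub>")
  case True
  have "d x = \<zero>\<^bsub>A\<^esub>" if "x \<in> carrier A" for x
    using that by (induction x rule: homogeneous_induct) (use True in \<open>auto simp: d_add\<close>)
  then show ?thesis by blast
next
  case False
  then obtain n a where a: "a \<in> gr n" "d a \<noteq> \<zero>\<^bsub>A\<^esub>" by blast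
  then have ac: "a \<in> carrier A" by (simp add: gr_carrier)
  have "d a \<in> ker_comp A gr d (n + 1)"
    using a(1) ac by (simp add: ker_comp_iff d_degree d_square)
  then obtain y where y: "y \<in> ker_comp A gr d (- (n + 1))" "d a \<otimes>\<^bsub>A\<^esub> y = \<one>\<^bsub>A\<^esub>"
    using homogeneous_cycle_inverse a(2) by blast
  have "x \<in> d ` carrier A" if x: "x \<in> cycles A d" for x
  proof -
    have xc: "x \<in> carrier A" and yc: "y \<in> carrier A"
      using x y(1) by (simp_all add: cycles_carrier ker_comp_closed)
    \<comment> \<open>Since y and x are cycles, the differential acts on a alone and gives (d a) y x
      = x. Left multiplication by a y is thus a contraction on cycles.\<close>
    have "d (a \<otimes>\<^bsub>A\<^esub> y \<otimes>\<^bsub>A\<^esub> x) = x"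
      using d_mult_cycles[OF _ x] d_mult_cycles[OF ac ker_comp_cycles[OF y(1)]] ac yc y(2) xc by simp
    then show ?thesis using ac yc xc by (metis A.m_closed imageI)
  qed
  then show ?thesis using acyclicI by blast
qed

end

text \<open>\<open>finsum\<close> depends on the carrier of its ring. This passes between sums in
  the Laurent ring, formed in \<open>ker_ring0\<close>, and sums computed in
  \<open>A\<close>.\<close>

lemma (in ring) finsum_subring:
  assumes "subring H R" "finite S" "\<And>i. i \<in> S \<Longrightarrow> f i \<in> H"
  shows "finsum (R\<lparr>carrier := H\<rparr>) f S = finsum R f S"
proof -
  interpret H: ring "R\<lparr>carrier := H\<rparr>" using subring_is_ring[OF assms(1)] .
  show ?thesis
    using assms(2,3)
  proof (induction S rule: finite_induct)
    case (insert i S)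
    moreover have "f j \<in> carrier R" if "j \<in> insert i S" for j
      using that insert.prems subringE(1)[OF assms(1)] by blast
    ultimately show ?case by (simp add: H.finsum_insert finsum_insert Pi_def)
  qed simp
qed

section \<open>Laurent coefficients of cycles\<close>

text \<open>Minimality of the degree of T enters as divisibility, the form in which it is applied: a
  cycle has no components outside degrees n m, and in degree n m it can be divided by
  \<open>T^n\<close>.\<close>

locale periodic_dg_division_algebra = dg_division_algebra K A gr d
  for K :: "('k, 'm) ring_scheme" and A :: "('k, 'a, 'n) module_scheme"
    and gr :: "int \<Rightarrow> 'a set" and d :: "'a \<Rightarrow> 'a" +
  fixes T :: 'a and m :: int
  assumes T_ker: "T \<in> ker_comp A gr d m" and T_nonzero: "T \<noteq> \<zero>\<^bsub>A\<^esub>" and m_nonzero: "m \<noteq> 0"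
    and degree_dvd: "x \<in> ker_comp A gr d n \<Longrightarrow> x \<noteq> \<zero>\<^bsub>A\<^esub> \<Longrightarrow> m dvd n"
begin

text \<open>Taking powers in the group of units makes the exponent law available for negative
  exponents.\<close>

definition Tpow :: "int \<Rightarrow> 'a" where
  "Tpow n = T [^]\<^bsub>units_of A\<^esub> n"

text \<open>The automorphism \<sigma> is \<open>conj 1\<close>. Having all exponents at once gives
  its powers and its inverse by an explicit formula.\<close>

definition conj :: "int \<Rightarrow> 'a \<Rightarrow> 'a" where
  "conj n r = Tpow n \<otimes>\<^bsub>A\<^esub> r \<otimes>\<^bsub>A\<^esub> Tpow (- n)"

text \<open>The factor \<open>T^{-n}\<close> stands on the right because Laurent coefficients are
  written on the left of \<open>T^n\<close>.\<close>

definition coeffs :: "'a \<Rightarrow> int \<Rightarrow> 'a" where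
  "coeffs x n = component x (n * m) \<otimes>\<^bsub>A\<^esub> Tpow (- n)"

sublocale U: group "units_of A"
  by (rule A.units_group)

lemma T_unit: "T \<in> carrier (units_of A)"
proof -
  obtain y where "y \<in> ker_comp A gr d (- m)" "y \<otimes>\<^bsub>A\<^esub> T = \<one>\<^bsub>A\<^esub>" "T \<otimes>\<^bsub>A\<^esub> y = \<one>\<^bsub>A\<^esub>"
    using homogeneous_cycle_inverse[OF T_ker T_nonzero] by blast
  then show ?thesis
    using ker_comp_closed[OF T_ker] ker_comp_closed by (auto simp: units_of_carrier Units_def)
qed

lemma Tpow_closed [simp]: "Tpow n \<in> carrier A"
  using U.int_pow_closed[OF T_unit, of n] by (simp add: Tpow_def units_of_carrier Units_def)

lemma Tpow_0 [simp]: "Tpow 0 = \<one>\<^bsub>A\<^esub>"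
  by (simp add: Tpow_def units_of_one)

lemma Tpow_1 [simp]: "Tpow 1 = T"
  using T_unit by (simp add: Tpow_def)

lemma Tpow_add: "Tpow i \<otimes>\<^bsub>A\<^esub> Tpow j = Tpow (i + j)"
  using U.int_pow_mult[OF T_unit, of i j] by (simp add: Tpow_def units_of_mult)

lemma Tpow_cancel_right: "x \<in> carrier A \<Longrightarrow> x \<otimes>\<^bsub>A\<^esub> Tpow i \<otimes>\<^bsub>A\<^esub> Tpow j = x \<otimes>\<^bsub>A\<^esub> Tpow (i + j)"
  by (simp add: A.m_assoc Tpow_add)

lemma Tpow_cancel_left: "x \<in> carrier A \<Longrightarrow> Tpow i \<otimes>\<^bsub>A\<^esub> (Tpow j \<otimes>\<^bsub>A\<^esub> x) = Tpow (i + j) \<otimes>\<^bsub>A\<^esub> x"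
  by (simp add: A.m_assoc[symmetric] Tpow_add)

lemma Tpow_ker: "Tpow n \<in> ker_comp A gr d (n * m)"
proof (induction n rule: int_induct[where k = 0])
  case base
  then show ?case by (simp add: ker_comp_iff one_gr d_one)
next
  case (step1 i)
  then show ?case
    using ker_comp_mult[OF step1(2) T_ker] Tpow_add[of i 1] by (simp add: algebra_simps)
next
  case (step2 i)
  obtain y where y: "y \<in> ker_comp A gr d (- m)" "y \<otimes>\<^bsub>A\<^esub> T = \<one>\<^bsub>A\<^esub>"
    using homogeneous_cycle_inverse[OF T_ker T_nonzero] by blast
  \<comment> \<open>The inverse in the group of units carries no degree information; uniqueness of
    inverses identifies it with the homogeneous cycle y.\<close>
  have "Tpow (- 1) = y"
    using A.inv_unique[OF y(2), of "Tpow (- 1)"] Tpow_add[of 1 "- 1"] ker_comp_closed[OF y(1)]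
      ker_comp_closed[OF T_ker] by simp
  then show ?case
    using ker_comp_mult[OF step2(2) y(1)] Tpow_add[of i "- 1"] by (simp add: algebra_simps)
qed

lemma conj_ker: "r \<in> ker_comp A gr d 0 \<Longrightarrow> conj n r \<in> ker_comp A gr d 0"
  using ker_comp_mult[OF ker_comp_mult[OF Tpow_ker[of n], of r 0] Tpow_ker[of "- n"]]
  by (simp add: conj_def)

lemma conj_conj: "r \<in> carrier A \<Longrightarrow> conj i (conj j r) = conj (i + j) r"
  by (simp add: conj_def Tpow_cancel_left A.m_assoc Tpow_add add.commute)

lemma conj_0: "r \<in> carrier A \<Longrightarrow> conj 0 r = r"
  by (simp add: conj_def)

lemma conj_Tpow: "r \<in> carrier A \<Longrightarrow> conj n r \<otimes>\<^bsub>A\<^esub> Tpow n = Tpow n \<otimes>\<^bsub>A\<^esub> r"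
  by (simp add: conj_def Tpow_cancel_right)

lemma conj_mult:
  "r \<in> carrier A \<Longrightarrow> s \<in> carrier A \<Longrightarrow> conj n (r \<otimes>\<^bsub>A\<^esub> s) = conj n r \<otimes>\<^bsub>A\<^esub> conj n s"
  by (simp add: conj_def A.m_assoc Tpow_cancel_left)

lemma conj_add:
  "r \<in> carrier A \<Longrightarrow> s \<in> carrier A \<Longrightarrow> conj n (r \<oplus>\<^bsub>A\<^esub> s) = conj n r \<oplus>\<^bsub>A\<^esub> conj n s"
  by (simp add: conj_def A.l_distr A.r_distr)

lemma conj_one: "conj n \<one>\<^bsub>A\<^esub> = \<one>\<^bsub>A\<^esub>"
  by (simp add: conj_def Tpow_add)

lemma conj_bij: "bij_betw (conj 1) (ker_comp A gr d 0) (ker_comp A gr d 0)"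
  by (rule bij_betw_byWitness[where f' = "conj (- 1)"])
    (auto simp: conj_conj conj_0 conj_ker ker_comp_closed)

lemma conj_ring_iso: "conj 1 \<in> ring_iso (ker_ring0 A gr d) (ker_ring0 A gr d)"
  by (rule ring_iso_memI)
    (use conj_bij in \<open>auto simp: ker_ring0_def conj_ker conj_mult conj_add conj_one ker_comp_closed\<close>)

text \<open>\<open>aut_pow\<close> uses \<open>inv_into\<close> for negative exponents, which is
  controlled only on \<open>R_0\<close>; \<open>conj_ker\<close> keeps all iterates there.\<close>

lemma aut_pow_conj:
  assumes r: "r \<in> ker_comp A gr d 0"
  shows "aut_pow (ker_ring0 A gr d) (conj 1) i r = conj i r"
proof -
  have pos: "(conj 1 ^^ k) r = conj (int k) r" for k
    by (induction k) (use r in \<open>simp_all add: conj_conj conj_0 ker_comp_closed\<close>)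
  have inv: "inv_into (ker_comp A gr d 0) (conj 1) s = conj (- 1) s" if "s \<in> ker_comp A gr d 0" for s
    by (rule inv_into_f_eq)
      (use that conj_bij in \<open>simp_all add: bij_betw_def conj_ker conj_conj conj_0 ker_comp_closed\<close>)
  have neg: "(inv_into (ker_comp A gr d 0) (conj 1) ^^ k) r = conj (- int k) r" for k
    by (induction k) (use r in \<open>simp_all add: inv conj_ker conj_conj conj_0 ker_comp_closed\<close>)
  show ?thesis
    using pos[of "nat i"] neg[of "nat (- i)"] by (simp add: aut_pow_def ker_ring0_def)
qed

lemma coeffs_ker: "x \<in> cycles A d \<Longrightarrow> coeffs x n \<in> ker_comp A gr d 0"
  using ker_comp_mult[OF component_cycles[of x "n * m"] Tpow_ker[of "- n"]] by (simp add: coeffs_def)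

lemma coeffs_Tpow: "x \<in> carrier A \<Longrightarrow> coeffs x n \<otimes>\<^bsub>A\<^esub> Tpow n = component x (n * m)"
  by (simp add: coeffs_def Tpow_cancel_right component_closed)

lemma coeffs_eq_zero: "x \<in> carrier A \<Longrightarrow> coeffs x n = \<zero>\<^bsub>A\<^esub> \<longleftrightarrow> component x (n * m) = \<zero>\<^bsub>A\<^esub>"
  using coeffs_Tpow[of x n] by (auto simp: coeffs_def)

lemma component_cycles_zero: "x \<in> cycles A d \<Longrightarrow> \<not> m dvd k \<Longrightarrow> component x k = \<zero>\<^bsub>A\<^esub>"
  using degree_dvd component_cycles by blast

lemma coeffs_finite:
  assumes "x \<in> carrier A"
  shows "finite {n. coeffs x n \<noteq> \<zero>\<^bsub>A\<^esub>}"
proof (rule finite_imageD)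
  show "finite ((\<lambda>n. n * m) ` {n. coeffs x n \<noteq> \<zero>\<^bsub>A\<^esub>})"
    by (rule finite_subset[OF _ component_finite[OF assms]]) (use assms in \<open>auto simp: coeffs_eq_zero\<close>)
  show "inj_on (\<lambda>n. n * m) {n. coeffs x n \<noteq> \<zero>\<^bsub>A\<^esub>}"
    using m_nonzero by (simp add: inj_on_def)
qed

text \<open>Components in degrees n m are recovered by multiplying back with \<open>T^n\<close>, and
  all others vanish for cycles.\<close>

lemma coeffs_inj: "inj_on coeffs (cycles A d)"
proof (rule inj_onI)
  fix x y assume x: "x \<in> cycles A d" and y: "y \<in> cycles A d" and eq: "coeffs x = coeffs y"
  show "x = y"
  proof (rule component_eqI)
    show "x \<in> carrier A" "y \<in> carrier A" using x y by (simp_all add: cycles_carrier)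
    fix k show "component x k = component y k"
    proof (cases "m dvd k")
      case True
      then obtain n where "k = n * m" by (metis dvd_div_mult_self)
      then show ?thesis
        using coeffs_Tpow[of x n] coeffs_Tpow[of y n] x y eq by (simp add: cycles_carrier)
    qed (use x y in \<open>simp add: component_cycles_zero\<close>)
  qed
qed

lemma coeffs_add:
  "x \<in> carrier A \<Longrightarrow> y \<in> carrier A \<Longrightarrow> coeffs (x \<oplus>\<^bsub>A\<^esub> y) n = coeffs x n \<oplus>\<^bsub>A\<^esub> coeffs y n"
  by (simp add: coeffs_def component_add A.l_distr component_closed)

lemma coeffs_homogeneous:
  "x \<in> gr k \<Longrightarrow> coeffs x n = (if n * m = k then x \<otimes>\<^bsub>A\<^esub> Tpow (- n) else \<zero>\<^bsub>A\<^esub>)"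
  by (simp add: coeffs_def component_homogeneous)

text \<open>With c and e the coefficients of x and y, \<open>x_{im} y_{(n-i)m} T^{-n} = c_i T^i
  (e_{n-i} T^{n-i}) T^{-n} = c_i (T^i e_{n-i} T^{-i})\<close>.\<close>

lemma coeffs_mult:
  assumes "x \<in> cycles A d" "y \<in> carrier A"
  shows "coeffs (x \<otimes>\<^bsub>A\<^esub> y) n =
    (\<Oplus>\<^bsub>A\<^esub>i\<in>{i. coeffs x i \<noteq> \<zero>\<^bsub>A\<^esub>}. coeffs x i \<otimes>\<^bsub>A\<^esub> conj i (coeffs y (n - i)))"
proof -
  let ?S = "{i. coeffs x i \<noteq> \<zero>\<^bsub>A\<^esub>}"
  let ?f = "\<lambda>k. component x k \<otimes>\<^bsub>A\<^esub> component y (n * m - k)"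
  have x: "x \<in> carrier A" using assms(1) by (rule cycles_carrier)
  have fin: "finite ?S" using x by (rule coeffs_finite)
  have f: "?f k \<in> carrier A" for k using x assms(2) by (simp add: component_closed)
  \<comment> \<open>The degrees occurring in the cycle x are multiples of m, so the convolution can
    be reindexed injectively along i -> i m.\<close>
  have supp: "{k. component x k \<noteq> \<zero>\<^bsub>A\<^esub>} \<subseteq> (\<lambda>i. i * m) ` ?S"
  proof
    fix k assume k: "k \<in> {k. component x k \<noteq> \<zero>\<^bsub>A\<^esub>}"
    then have "m dvd k" using component_cycles_zero[OF assms(1)] by blast
    then obtain i where "k = i * m" by (metis dvd_div_mult_self)
    then show "k \<in> (\<lambda>i. i * m) ` ?S" using k x by (auto simp: coeffs_eq_zero)
  qed
  have inj: "inj_on (\<lambda>i. i * m) ?S" using m_nonzero by (simp add: inj_on_def)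
  have "component (x \<otimes>\<^bsub>A\<^esub> y) (n * m) = (\<Oplus>\<^bsub>A\<^esub>k\<in>(\<lambda>i. i * m) ` ?S. ?f k)"
    using x assms(2) fin supp by (intro component_mult) auto
  also have "\<dots> = (\<Oplus>\<^bsub>A\<^esub>i\<in>?S. ?f (i * m))"
    using f inj by (intro M.finsum_reindex) auto
  finally have "coeffs (x \<otimes>\<^bsub>A\<^esub> y) n = (\<Oplus>\<^bsub>A\<^esub>i\<in>?S. ?f (i * m)) \<otimes>\<^bsub>A\<^esub> Tpow (- n)"
    by (simp add: coeffs_def)
  also have "\<dots> = (\<Oplus>\<^bsub>A\<^esub>i\<in>?S. ?f (i * m) \<otimes>\<^bsub>A\<^esub> Tpow (- n))"
    using f fin by (intro A.finsum_ldistr) auto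
  also have "\<dots> = (\<Oplus>\<^bsub>A\<^esub>i\<in>?S. coeffs x i \<otimes>\<^bsub>A\<^esub> conj i (coeffs y (n - i)))"
  proof (rule M.finsum_cong')
    fix i
    have "conj i (coeffs y (n - i)) = Tpow i \<otimes>\<^bsub>A\<^esub> (component y ((n - i) * m) \<otimes>\<^bsub>A\<^esub> Tpow (- n))"
      using assms(2) by (simp add: conj_def coeffs_def A.m_assoc Tpow_add component_closed)
    then have "coeffs x i \<otimes>\<^bsub>A\<^esub> conj i (coeffs y (n - i)) =
        coeffs x i \<otimes>\<^bsub>A\<^esub> Tpow i \<otimes>\<^bsub>A\<^esub> (component y ((n - i) * m) \<otimes>\<^bsub>A\<^esub> Tpow (- n))"
      using x assms(2) by (simp add: A.m_assoc coeffs_def component_closed)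
    then show "?f (i * m) \<otimes>\<^bsub>A\<^esub> Tpow (- n) = coeffs x i \<otimes>\<^bsub>A\<^esub> conj i (coeffs y (n - i))"
      using x assms(2) by (simp add: coeffs_Tpow A.m_assoc component_closed left_diff_distrib)
  qed (use x assms(2) in \<open>auto simp: coeffs_def conj_def component_closed\<close>)
  finally show ?thesis .
qed

lemma coeffs_surj:
  assumes f: "\<And>n. f n \<in> ker_comp A gr d 0" and fin: "finite {n. f n \<noteq> \<zero>\<^bsub>A\<^esub>}"
  shows "\<exists>x\<in>cycles A d. coeffs x = f"
proof
  let ?S = "{n. f n \<noteq> \<zero>\<^bsub>A\<^esub>}"
  let ?g = "\<lambda>n. f n \<otimes>\<^bsub>A\<^esub> Tpow n"
  let ?x = "\<Oplus>\<^bsub>A\<^esub>n\<in>?S. ?g n"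
  have g: "?g n \<in> ker_comp A gr d (n * m)" for n
    using ker_comp_mult[OF f Tpow_ker] by simp
  have gc: "?g n \<in> carrier A" for n using g by (rule ker_comp_closed)
  interpret Z: ring "A\<lparr>carrier := cycles A d\<rparr>" by (rule A.subring_is_ring[OF subring_cycles])
  have "?x = finsum (A\<lparr>carrier := cycles A d\<rparr>) ?g ?S"
    using g ker_comp_cycles by (intro A.finsum_subring[OF subring_cycles fin, symmetric]) blast
  also have "\<dots> \<in> carrier (A\<lparr>carrier := cycles A d\<rparr>)"
    using g ker_comp_cycles by (intro Z.finsum_closed) (simp add: Pi_def, blast)
  finally show "?x \<in> cycles A d" by simp
  have "coeffs ?x n = f n" for n
  proof -
    have "component ?x (n * m) = (\<Oplus>\<^bsub>A\<^esub>i\<in>?S. component (?g i) (n * m))"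
      using fin gc by (rule component_finsum)
    \<comment> \<open>The index n may lie outside the support; it is adjoined, with term 0 in that
      case, so that the sum collapses to its n-th term.\<close>
    also have "\<dots> = (\<Oplus>\<^bsub>A\<^esub>i\<in>?S \<union> {n}. if n = i then ?g i else \<zero>\<^bsub>A\<^esub>)"
    proof (rule M.add.finprod_mono_neutral_cong_left)
      show "component (?g i) (n * m) = (if n = i then ?g i else \<zero>\<^bsub>A\<^esub>)" for i
        using g[of i] m_nonzero component_homogeneous[of "?g i" "i * m" "n * m"]
        by (auto simp: ker_comp_iff)
    qed (use fin gc in auto)
    also have "\<dots> = ?g n"
      using fin gc by (intro M.finsum_singleton) auto
    finally show ?thesis
      using ker_comp_closed[OF f] by (simp add: coeffs_def Tpow_cancel_right)
  qed
  then show "coeffs ?x = f" by blast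
qed

text \<open>Proved in this direction because \<open>coeffs\<close> has a closed formula; the map out
  of the Laurent ring is then its inverse.\<close>

lemma coeffs_ring_iso:
  "coeffs \<in> ring_iso (ker_ring A d) (twisted_laurent (ker_ring0 A gr d) (conj 1))"
proof (rule ring_iso_memI)
  let ?L = "twisted_laurent (ker_ring0 A gr d) (conj 1)"
  have L: "carrier ?L = {f. (\<forall>n. f n \<in> ker_comp A gr d 0) \<and> finite {n. f n \<noteq> \<zero>\<^bsub>A\<^esub>}}"
    by (simp add: twisted_laurent_def ker_ring0_def)
  show "coeffs x \<in> carrier ?L" if "x \<in> carrier (ker_ring A d)" for x
    using that by (simp add: L ker_ring_def coeffs_ker coeffs_finite cycles_carrier)
  show "coeffs (x \<otimes>\<^bsub>ker_ring A d\<^esub> y) = coeffs x \<otimes>\<^bsub>?L\<^esub> coeffs y"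
    if "x \<in> carrier (ker_ring A d)" "y \<in> carrier (ker_ring A d)" for x y
  proof
    fix n
    let ?S = "{i. coeffs x i \<noteq> \<zero>\<^bsub>A\<^esub>}"
    let ?h = "\<lambda>i. coeffs x i \<otimes>\<^bsub>A\<^esub> conj i (coeffs y (n - i))"
    have x: "x \<in> cycles A d" and y: "y \<in> cycles A d"
      using that by (simp_all add: ker_ring_def)
    have h: "?h i \<in> ker_comp A gr d 0" for i
      using ker_comp_mult[OF coeffs_ker[OF x] conj_ker[OF coeffs_ker[OF y]]] by simp
    have "finsum (ker_ring0 A gr d) ?h ?S = finsum A ?h ?S"
      unfolding ker_ring0_def
      using h coeffs_finite[OF cycles_carrier[OF x]] by (intro A.finsum_subring[OF subring_ker_comp0])
    then show "coeffs (x \<otimes>\<^bsub>ker_ring A d\<^esub> y) n = (coeffs x \<otimes>\<^bsub>?L\<^esub> coeffs y) n"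
      using coeffs_mult[OF x cycles_carrier[OF y], of n]
      by (simp add: twisted_laurent_def ker_ring_def aut_pow_conj[OF coeffs_ker[OF y]])
        (simp add: ker_ring0_def)
  qed
  show "coeffs (x \<oplus>\<^bsub>ker_ring A d\<^esub> y) = coeffs x \<oplus>\<^bsub>?L\<^esub> coeffs y"
    if "x \<in> carrier (ker_ring A d)" "y \<in> carrier (ker_ring A d)" for x y
    using that
    by (auto simp: twisted_laurent_def ker_ring_def ker_ring0_def coeffs_add cycles_carrier)
  show "coeffs \<one>\<^bsub>ker_ring A d\<^esub> = \<one>\<^bsub>?L\<^esub>"
    using m_nonzero coeffs_homogeneous[OF one_gr]
    by (auto simp: twisted_laurent_def ker_ring_def ker_ring0_def)
  show "bij_betw coeffs (carrier (ker_ring A d)) (carrier ?L)"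
    unfolding bij_betw_def
  proof
    show "coeffs ` carrier (ker_ring A d) = carrier ?L"
      using coeffs_surj by (fastforce simp: L ker_ring_def coeffs_ker coeffs_finite cycles_carrier)
  qed (simp add: ker_ring_def coeffs_inj)
qed

lemma coeffs_comp:
  "coeffs ` ker_comp A gr d k = laurent_comp (ker_ring0 A gr d) (conj 1) m k"
proof
  show "coeffs ` ker_comp A gr d k \<subseteq> laurent_comp (ker_ring0 A gr d) (conj 1) m k"
    using coeffs_homogeneous coeffs_ker coeffs_finite
    by (auto simp: laurent_comp_def twisted_laurent_def ker_ring0_def ker_comp_cycles ker_comp_closed)
      (auto simp: ker_comp_iff split: if_splits)
  show "laurent_comp (ker_ring0 A gr d) (conj 1) m k \<subseteq> coeffs ` ker_comp A gr d k"
  proof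
    fix f assume "f \<in> laurent_comp (ker_ring0 A gr d) (conj 1) m k"
    then have f: "\<And>n. f n \<in> ker_comp A gr d 0" "finite {n. f n \<noteq> \<zero>\<^bsub>A\<^esub>}"
      and deg: "\<And>n. f n \<noteq> \<zero>\<^bsub>A\<^esub> \<Longrightarrow> n * m = k"
      by (auto simp: laurent_comp_def twisted_laurent_def ker_ring0_def)
    obtain x where x: "x \<in> cycles A d" "coeffs x = f" using coeffs_surj[OF f] by blast
    have xc: "x \<in> carrier A" using x(1) by (rule cycles_carrier)
    \<comment> \<open>If m does not divide k, then f and hence x are zero; otherwise only the degree
      k component of x can survive.\<close>
    have zero: "component x j = \<zero>\<^bsub>A\<^esub>" if "j \<noteq> k" for j
    proof (cases "m dvd j")
      case True
      then obtain n where "j = n * m" by (metis dvd_div_mult_self)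
      then show ?thesis using that deg[of n] x(2) coeffs_eq_zero[OF xc, of n] by auto
    qed (use x(1) in \<open>rule component_cycles_zero\<close>)
    have "component x k = x"
    proof (rule component_eqI)
      show "component (component x k) j = component x j" for j
        using zero component_homogeneous[OF component_gr[OF xc, of k], of j] by simp
    qed (use xc in \<open>simp_all add: component_closed\<close>)
    then have "x \<in> ker_comp A gr d k" using component_cycles[OF x(1), of k] by simp
    then show "f \<in> coeffs ` ker_comp A gr d k" using x(2) by blast
  qed
qed

lemma ker_ring_twisted_laurent:
  fixes \<phi> :: "(int \<Rightarrow> 'a) \<Rightarrow> 'a"
  defines "\<phi> \<equiv> inv_into (cycles A d) coeffs"
  shows "\<phi> \<in> ring_iso (twisted_laurent (ker_ring0 A gr d) (conj 1)) (ker_ring A d)"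
    and "r \<in> ker_comp A gr d 0 \<Longrightarrow> \<phi> (laurent_monom (ker_ring0 A gr d) r 0) = r"
    and "\<phi> (laurent_monom (ker_ring0 A gr d) \<one>\<^bsub>ker_ring0 A gr d\<^esub> 1) = T"
    and "\<phi> ` laurent_comp (ker_ring0 A gr d) (conj 1) m k = ker_comp A gr d k"
proof -
  have inv: "\<phi> (coeffs x) = x" if "x \<in> cycles A d" for x
    unfolding \<phi>_def using coeffs_inj that by (rule inv_into_f_f)
  have "ring (ker_ring A d)"
    unfolding ker_ring_def by (rule A.subring_is_ring[OF subring_cycles])
  from ring_iso_set_sym[OF this coeffs_ring_iso]
  show "\<phi> \<in> ring_iso (twisted_laurent (ker_ring0 A gr d) (conj 1)) (ker_ring A d)"
    by (simp add: \<phi>_def ker_ring_def)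
  show "\<phi> (laurent_monom (ker_ring0 A gr d) r 0) = r" if r: "r \<in> ker_comp A gr d 0"
  proof -
    have "coeffs r = laurent_monom (ker_ring0 A gr d) r 0"
      using r m_nonzero coeffs_homogeneous[of r 0] ker_comp_closed[OF r]
      by (auto simp: laurent_monom_def ker_ring0_def ker_comp_iff)
    then show ?thesis using inv[OF ker_comp_cycles[OF r]] by simp
  qed
  \<comment> \<open>The only coefficient of T sits at index 1, since T has degree m, and equals
    \<open>T T^{-1} = 1\<close>.\<close>
  have "coeffs T = laurent_monom (ker_ring0 A gr d) \<one>\<^bsub>ker_ring0 A gr d\<^esub> 1"
    using m_nonzero coeffs_homogeneous[of T m] T_ker Tpow_add[of 1 "- 1"]
    by (auto simp: laurent_monom_def ker_ring0_def ker_comp_iff)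
  then show "\<phi> (laurent_monom (ker_ring0 A gr d) \<one>\<^bsub>ker_ring0 A gr d\<^esub> 1) = T"
    using inv[OF ker_comp_cycles[OF T_ker]] by simp
  have "\<phi> ` coeffs ` ker_comp A gr d k = ker_comp A gr d k"
    using inv ker_comp_cycles by (force simp: image_image)
  then show "\<phi> ` laurent_comp (ker_ring0 A gr d) (conj 1) m k = ker_comp A gr d k"
    by (simp add: coeffs_comp)
qed

end

section \<open>The period: degrees of nonzero homogeneous cycles\<close>

context dg_division_algebra
begin

lemma ex_periodic_dg_division_algebra:
  assumes "k \<noteq> 0" "ker_comp A gr d k \<noteq> {\<zero>\<^bsub>A\<^esub>}"
  shows "\<exists>T m. periodic_dg_division_algebra K A gr d T m"
proof -
  define N where "N = {n. \<exists>x\<in>ker_comp A gr d n. x \<noteq> \<zero>\<^bsub>A\<^esub>}"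
  have minus: "- n \<in> N" if n: "n \<in> N" for n
  proof -
    obtain x where x: "x \<in> ker_comp A gr d n" "x \<noteq> \<zero>\<^bsub>A\<^esub>" using n by (auto simp: N_def)
    obtain y where y: "y \<in> ker_comp A gr d (- n)" "y \<otimes>\<^bsub>A\<^esub> x = \<one>\<^bsub>A\<^esub>"
      using homogeneous_cycle_inverse[OF x] by blast
    have "y \<noteq> \<zero>\<^bsub>A\<^esub>" using y(2) x ker_comp_closed[OF x(1)] by (metis A.l_null A.l_one)
    then show ?thesis using y(1) by (auto simp: N_def)
  qed
  have plus: "i + j \<in> N" if i: "i \<in> N" and j: "j \<in> N" for i j
  proof -
    obtain x where x: "x \<in> ker_comp A gr d i" "x \<noteq> \<zero>\<^bsub>A\<^esub>" using i by (auto simp: N_def)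
    obtain z where z: "z \<in> ker_comp A gr d j" "z \<noteq> \<zero>\<^bsub>A\<^esub>" using j by (auto simp: N_def)
    obtain y where y: "y \<in> ker_comp A gr d (- i)" "y \<otimes>\<^bsub>A\<^esub> x = \<one>\<^bsub>A\<^esub>"
      using homogeneous_cycle_inverse[OF x] by blast
    \<comment> \<open>Closure under addition needs a nonzero product; cancelling the invertible
      factor x recovers z, which is not 0.\<close>
    have "y \<otimes>\<^bsub>A\<^esub> (x \<otimes>\<^bsub>A\<^esub> z) = z"
      using x y z by (simp add: A.m_assoc[symmetric] ker_comp_closed)
    then have "x \<otimes>\<^bsub>A\<^esub> z \<noteq> \<zero>\<^bsub>A\<^esub>" using z(2) y(1) ker_comp_closed by (metis A.r_null)
    then show ?thesis using ker_comp_mult[OF x(1) z(1)] by (auto simp: N_def)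
  qed
  have "k \<in> N" using assms(2) ker_comp_zero[of k] by (auto simp: N_def)
  then have "int (nat \<bar>k\<bar>) \<in> N" using minus[of k] by (auto simp: abs_if)
  then have ex: "0 < nat \<bar>k\<bar> \<and> int (nat \<bar>k\<bar>) \<in> N" using assms(1) by auto
  define q where "q = (LEAST n. 0 < n \<and> int n \<in> N)"
  have q: "0 < q" "int q \<in> N"
    using LeastI[of "\<lambda>n. 0 < n \<and> int n \<in> N", OF ex] by (simp_all add: q_def)
  have min: "q \<le> n" if "0 < n" "int n \<in> N" for n
    unfolding q_def using that by (intro Least_le) simp
  have mult: "i * int q \<in> N" for i
  proof (induction i rule: int_induct[where k = 0])
    case base
    then show ?case using plus[OF q(2) minus[OF q(2)]] by simp
  next
    case (step1 i)
    then show ?case using plus[OF step1(2) q(2)] by (simp add: algebra_simps)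
  next
    case (step2 i)
    then show ?case using plus[OF step2(2) minus[OF q(2)]] by (simp add: algebra_simps)
  qed
  have dvd: "int q dvd n" if "n \<in> N" for n
  proof (rule ccontr)
    assume "\<not> int q dvd n"
    then have "n mod int q \<noteq> 0" by (simp only: dvd_eq_mod_eq_0 not_False_eq_True)
    then have pos: "0 < nat (n mod int q)"
      using q(1) pos_mod_sign[of "int q" n] by linarith
    \<comment> \<open>The remainder is n minus a multiple of q, hence a degree of a nonzero cycle.
      Being positive and below q, it contradicts minimality.\<close>
    have "n mod int q \<in> N"
      using plus[OF that mult[of "- (n div int q)"]] by (simp add: minus_mult_div_eq_mod mult.commute)
    then have "q \<le> nat (n mod int q)" using min[OF pos] pos by simp
    then show False using q(1) pos_mod_bound[of "int q" n] by linarith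
  qed
  obtain T where "T \<in> ker_comp A gr d (int q)" "T \<noteq> \<zero>\<^bsub>A\<^esub>" using q(2) by (auto simp: N_def)
  then have "periodic_dg_division_algebra K A gr d T (int q)"
    using q(1) dvd by unfold_locales (auto simp: N_def)
  then show ?thesis by blast
qed

end

text \<open>A bare ring isomorphism would not express the claim: \<phi> also fixes
  \<open>R_0\<close> and matches components in every degree, which places T in the nonzero degree
  m.\<close>

theorem theorem2p9:
  fixes K :: "('k, 'm) ring_scheme" and A :: "('k, 'a, 'n) module_scheme"
    and gr :: "int \<Rightarrow> 'a set" and d :: "'a \<Rightarrow> 'a"
  assumes "dg_division_algebra K A gr d"
    and "hom_left_regular A gr d = hom_right_regular A gr d"
  shows "(acyclic_dg A d \<or> (\<forall>x\<in>carrier A. d x = \<zero>\<^bsub>A\<^esub>)) \<and>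
    ((\<forall>n. n \<noteq> 0 \<longrightarrow> ker_comp A gr d n = {\<zero>\<^bsub>A\<^esub>}) \<or>
     (let R = ker_ring A d; R0 = ker_ring0 A gr d in
      \<exists>\<sigma>\<in>ring_iso R0 R0. \<exists>m \<phi> T. m \<noteq> 0 \<and>
        \<phi> \<in> ring_iso (twisted_laurent R0 \<sigma>) R \<and>
        (\<forall>r\<in>carrier R0. \<phi> (laurent_monom R0 r 0) = r) \<and>
        \<phi> (laurent_monom R0 \<one>\<^bsub>R0\<^esub> 1) = T \<and>
        (\<forall>k. \<phi> ` laurent_comp R0 \<sigma> m k = ker_comp A gr d k) \<and>
        (\<forall>r\<in>carrier R0. T \<otimes>\<^bsub>R\<^esub> r = \<sigma> r \<otimes>\<^bsub>R\<^esub> T)))"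
proof -
  interpret dg_division_algebra K A gr d by (rule assms(1))
  have "\<exists>\<sigma>\<in>ring_iso (ker_ring0 A gr d) (ker_ring0 A gr d). \<exists>m \<phi> T. m \<noteq> 0 \<and>
        \<phi> \<in> ring_iso (twisted_laurent (ker_ring0 A gr d) \<sigma>) (ker_ring A d) \<and>
        (\<forall>r\<in>carrier (ker_ring0 A gr d). \<phi> (laurent_monom (ker_ring0 A gr d) r 0) = r) \<and>
        \<phi> (laurent_monom (ker_ring0 A gr d) \<one>\<^bsub>ker_ring0 A gr d\<^esub> 1) = T \<and>
        (\<forall>k. \<phi> ` laurent_comp (ker_ring0 A gr d) \<sigma> m k = ker_comp A gr d k) \<and>
        (\<forall>r\<in>carrier (ker_ring0 A gr d). T \<otimes>\<^bsub>ker_ring A d\<^esub> r = \<sigma> r \<otimes>\<^bsub>ker_ring A d\<^esub> T)"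
      (is ?laurent)
    if "k \<noteq> 0" "ker_comp A gr d k \<noteq> {\<zero>\<^bsub>A\<^esub>}" for k
  proof -
    obtain T m where "periodic_dg_division_algebra K A gr d T m"
      using ex_periodic_dg_division_algebra[OF \<open>k \<noteq> 0\<close> \<open>ker_comp A gr d k \<noteq> {\<zero>\<^bsub>A\<^esub>}\<close>] by blast
    then interpret P: periodic_dg_division_algebra K A gr d T m .
    have "T \<otimes>\<^bsub>ker_ring A d\<^esub> r = P.conj 1 r \<otimes>\<^bsub>ker_ring A d\<^esub> T"
      if "r \<in> carrier (ker_ring0 A gr d)" for r
      using that P.conj_Tpow[of r 1] ker_comp_closed by (simp add: ker_ring_def ker_ring0_def)
    moreover have "carrier (ker_ring0 A gr d) = ker_comp A gr d 0" by (simp add: ker_ring0_def)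
    ultimately show ?thesis
      by (intro bexI[OF _ P.conj_ring_iso] exI[of _ m] exI[of _ T]
          exI[of _ "inv_into (cycles A d) P.coeffs"] conjI ballI allI)
        (simp_all only: P.m_nonzero P.ker_ring_twisted_laurent not_False_eq_True)
  qed
  then have "(\<forall>n. n \<noteq> 0 \<longrightarrow> ker_comp A gr d n = {\<zero>\<^bsub>A\<^esub>}) \<or> ?laurent"
    by blast
  with acyclic_or_zero_differential show ?thesis
    unfolding Let_def by (rule conjI)
qed

end
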